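(* Let $G=G(n,1/2)$ be the binomial random graph on $n$ vertices. Then with probability tending to $1$ as $n\to\infty$, $HG(G)\ge n^{1-o(1)}$.
   Context: $G(n,1/2)$ is the random graph on $n$ labeled vertices in which each pair of vertices is joined by an edge independently with probability $1/2$. The hat guessing game on a finite simple graph $G$ with $q$ colors: each vertex (player) is assigned a hat whose color is an arbitrary element of a fixed set $Q$ of $q$ colors. Each player sees the hat colors of exactly its neighbors in $G$ (not its own). Before the colors are assigned, the players fix a deterministic guessing strategy: for each vertex $w$, a function from the colorings of the neighbors of $w$ to $Q$, which is $w$'s guess for its own color. No communication is allowed. The strategy is winning if for every assignment of colors from $Q$ to all vertices, at least one vertex guesses its own color correctly. The hat guessing number $HG(G)$ is the largest integer $q$ for which a winning strategy with $q$ colors exists. *)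

theory Defs
  imports Complex_Main "HOL-Library.FuncSet"
begin

definition all_edges :: "nat \<Rightarrow> nat set set" where
  "all_edges n = {e. e \<subseteq> {0..<n} \<and> card e = 2}"

definition graphs :: "nat \<Rightarrow> nat set set set" where
  "graphs n = Pow (all_edges n)"

definition colourings :: "nat \<Rightarrow> nat \<Rightarrow> (nat \<Rightarrow> nat) set" where
  "colourings n q = PiE {0..<n} (\<lambda>_. {0..<q})"

definition winning_strategy ::
  "nat \<Rightarrow> nat set set \<Rightarrow> nat \<Rightarrow> (nat \<Rightarrow> (nat \<Rightarrow> nat) \<Rightarrow> nat) \<Rightarrow> bool" where
  "winning_strategy n E q f \<longleftrightarrow>
     (\<forall>w<n. \<forall>c c'. (\<forall>u. {w, u} \<in> E \<longrightarrow> c u = c' u) \<longrightarrow> f w c = f w c') \<and>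
     (\<forall>w<n. \<forall>c. f w c < q) \<and>
     (\<forall>c \<in> colourings n q. \<exists>w<n. f w c = c w)"

definition hat_guessing_number :: "nat \<Rightarrow> nat set set \<Rightarrow> nat" where
  "hat_guessing_number n E = (GREATEST q. \<exists>f. winning_strategy n E q f)"

end

theory Submission
  imports Defs "HOL-Library.Disjoint_Sets" "HOL-Real_Asymp.Real_Asymp"
begin

text \<open>
  Take a clique \<open>D\<close> of size \<open>d\<close> with \<open>d\<^bsup>d\<^esup> \<ge> n\<close> but \<open>2\<^bsup>d\<^esup> = n\<^bsup>o(1)\<^esup>\<close>, and a set \<open>P\<close> of \<open>N\<close> common neighbours
  of \<open>D\<close>; both exist in a random graph with \<open>N\<close> close to \<open>n / 2\<^bsup>d\<^esup>\<close>. Each vertex of \<open>P\<close> guesses a random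
  function of the colours on \<open>D\<close>. With \<open>q = n\<^bsup>1-\<epsilon>\<^esup>\<close> colours, a union bound shows that for every colouring
  of \<open>P\<close> fewer than \<open>d\<^bsup>d\<^esup>\<close> colourings of \<open>D\<close> make all of \<open>P\<close> guess wrong. The clique sees \<open>P\<close>, hence
  knows this set \<open>S\<close> of colourings. It wins on \<open>S\<close> if the points of \<open>S\<close> can be matched injectively to
  axis-parallel lines through them: the player whose coordinate varies along the line guesses the point
  matched to the line. By Hall's theorem this is possible when every \<open>T \<subseteq> S\<close> meets at least
  \<open>\<bar>T\<bar>\<close> lines, which for \<open>\<bar>T\<bar> \<le> d\<^bsup>d\<^esup>\<close> is the Loomis--Whitney inequality.
\<close>

section \<open>Guessing on a clique\<close>

text \<open>Hall's theorem by the Halmos-Vaughan induction: if every proper nonempty subfamily has a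
  surplus neighbour, one index may be matched arbitrarily; otherwise a tight subfamily and its
  complement are matched separately.\<close>

lemma marriage:
  fixes A :: "'a \<Rightarrow> 'b set"
  assumes "finite I"
    and "\<And>i. i \<in> I \<Longrightarrow> finite (A i)"
    and "\<And>J. J \<subseteq> I \<Longrightarrow> card J \<le> card (\<Union>i\<in>J. A i)"
  shows "\<exists>f. inj_on f I \<and> (\<forall>i\<in>I. f i \<in> A i)"
  using assms
proof (induction I arbitrary: A rule: finite_psubset_induct)
  case (psubset I)
  note fin = psubset.prems(1) and hall = psubset.prems(2)
  have finU: "finite (\<Union>i\<in>J. A i)" if "J \<subseteq> I" for J
    using that fin psubset.hyps by (auto intro: finite_subset)
  show ?case
  proof (cases "I = {}")
    case False
    then obtain i where i: "i \<in> I" by blast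
    show ?thesis
    proof (cases "\<forall>J. J \<subset> I \<longrightarrow> J \<noteq> {} \<longrightarrow> card J < card (\<Union>i\<in>J. A i)")
      case True
      have "card {i} \<le> card (A i)" using hall[of "{i}"] i by simp
      then obtain a where a: "a \<in> A i" by fastforce
      have "\<exists>f. inj_on f (I - {i}) \<and> (\<forall>j\<in>I - {i}. f j \<in> A j - {a})"
      proof (rule psubset.IH)
        show "I - {i} \<subset> I" using i by blast
        show "finite (A j - {a})" if "j \<in> I - {i}" for j using that fin by simp
        show "card J \<le> card (\<Union>j\<in>J. A j - {a})" if J: "J \<subseteq> I - {i}" for J
        proof (cases "J = {}")
          case False
          have "card J < card (\<Union>j\<in>J. A j)" using J i False True by blast
          moreover have "(\<Union>j\<in>J. A j - {a}) = (\<Union>j\<in>J. A j) - {a}" by blast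
          moreover have "card (\<Union>j\<in>J. A j) \<le> Suc (card ((\<Union>j\<in>J. A j) - {a}))"
            using card_Diff1_le card_Suc_Diff1 finU[of J] J
            by (metis Diff_empty Diff_insert0 Diff_subset dual_order.trans le_Suc_eq order_refl)
          ultimately show ?thesis by simp
        qed simp
      qed
      then obtain f where f: "inj_on f (I - {i})" "\<And>j. j \<in> I - {i} \<Longrightarrow> f j \<in> A j - {a}" by blast
      show ?thesis
        by (rule exI[of _ "f(i := a)"]) (use f a in \<open>auto simp: inj_on_def\<close>)
    next
      case False
      then obtain J where J: "J \<subset> I" "J \<noteq> {}" and le: "card (\<Union>i\<in>J. A i) \<le> card J"
        by (auto simp: not_less)
      define U where "U = (\<Union>i\<in>J. A i)"
      have "\<exists>f. inj_on f J \<and> (\<forall>j\<in>J. f j \<in> A j)"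
        by (rule psubset.IH) (use J fin hall in auto)
      then obtain f where f: "inj_on f J" "\<And>j. j \<in> J \<Longrightarrow> f j \<in> A j" by blast
      have "\<exists>g. inj_on g (I - J) \<and> (\<forall>j\<in>I - J. g j \<in> A j - U)"
      proof (rule psubset.IH)
        show "I - J \<subset> I" using J by blast
        show "finite (A j - U)" if "j \<in> I - J" for j using that fin by simp
        \<comment> \<open>As \<open>J\<close> is tight, \<open>U\<close> has at most
          \<open>card J\<close> elements, so Hall's condition for \<open>K \<union> J\<close> leaves
          at least \<open>card K\<close> elements outside \<open>U\<close>.\<close>
        show "card K \<le> card (\<Union>j\<in>K. A j - U)" if K: "K \<subseteq> I - J" for K
        proof -
          have finJK: "finite J" "finite K" using J K psubset.hyps by (auto intro: finite_subset)
          have "card K + card J = card (K \<union> J)"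
            using finJK K by (intro card_Un_disjoint[symmetric]) auto
          also have "\<dots> \<le> card (\<Union>j\<in>K \<union> J. A j)" using K J by (intro hall) auto
          also have "(\<Union>j\<in>K \<union> J. A j) = (\<Union>j\<in>K. A j - U) \<union> U" by (auto simp: U_def)
          also have "card \<dots> \<le> card (\<Union>j\<in>K. A j - U) + card U" by (rule card_Un_le)
          finally show ?thesis using le by (simp add: U_def)
        qed
      qed
      then obtain g where g: "inj_on g (I - J)" "\<And>j. j \<in> I - J \<Longrightarrow> g j \<in> A j - U" by blast
      have fU: "f j \<in> U" if "j \<in> J" for j using f(2) that by (auto simp: U_def)
      show ?thesis
      proof (intro exI conjI ballI)
        let ?h = "\<lambda>j. if j \<in> J then f j else g j"
        show "inj_on ?h I"
        proof (rule inj_onI)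
          fix j k assume jk: "j \<in> I" "k \<in> I" "?h j = ?h k"
          have "j \<in> J \<longleftrightarrow> k \<in> J"
            using jk g(2) fU by (metis Diff_iff)
          then show "j = k"
            using jk inj_onD[OF f(1), of j k] inj_onD[OF g(1), of j k] by (auto split: if_splits)
        qed
        show "?h j \<in> A j" if "j \<in> I" for j using that f g by auto
      qed
    qed
  qed simp
qed

text \<open>
  A Loomis--Whitney inequality \<open>\<Sum>\<^sub>i \<bar>\<pi>\<^sub>i T\<bar> \<ge> d \<bar>T\<bar>\<^bsup>1-1/d\<^esup>\<close>, linearised with a parameter \<open>r\<close> so that the
  induction over the slices of \<open>T\<close> needs only Bernoulli's inequality.
\<close>

lemma card_le_sum_projections:
  fixes T :: "('i \<Rightarrow> 'c) set" and r :: real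
  assumes "finite D" "finite T" "T \<subseteq> extensional D" "r > 0" "real (card T) \<le> r ^ card D"
  shows "real (card D) * real (card T) \<le> r * (\<Sum>i\<in>D. real (card ((\<lambda>x. restrict x (D - {i})) ` T)))"
  using assms
proof (induction D arbitrary: T r rule: finite_induct)
  case (insert a D)
  note finT = insert.prems(1) and r = insert.prems(3)
  define t where "t = real (card T)"
  define V where "V = (\<lambda>x. x a) ` T"
  define S where "S v = (\<lambda>x. restrict x D) ` {x \<in> T. x a = v}" for v
  define \<Lambda> where "\<Lambda> = (\<Sum>i\<in>insert a D. real (card ((\<lambda>x. restrict x (insert a D - {i})) ` T)))"
  have tr: "t \<le> r ^ Suc (card D)" using insert by (simp add: t_def)
  have finV: "finite V" using finT by (simp add: V_def)
  have finS: "finite (S v)" for v using finT by (simp add: S_def)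
  have inj: "inj_on (\<lambda>x. restrict x D) {x \<in> T. x a = v}" for v
  proof (rule inj_onI)
    fix x y assume xy: "x \<in> {x \<in> T. x a = v}" "y \<in> {x \<in> T. x a = v}" "restrict x D = restrict y D"
    show "x = y"
    proof
      fix i
      have ext: "x \<in> extensional (insert a D)" "y \<in> extensional (insert a D)"
        using xy insert.prems(2) by blast+
      consider "i = a" | "i \<in> D" | "i \<notin> insert a D" by blast
      then show "x i = y i"
      proof cases
        case 1 then show ?thesis using xy(1,2) by simp
      next
        case 2 then show ?thesis using fun_cong[OF xy(3), of i] by simp
      next
        case 3 then show ?thesis using ext[THEN extensional_arb] by simp
      qed
    qed
  qed
  have cardS: "card (S v) = card {x \<in> T. x a = v}" for v
    unfolding S_def by (rule card_image[OF inj])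
  have t_eq: "t = (\<Sum>v\<in>V. real (card (S v)))"
  proof -
    have "t = (\<Sum>x\<in>T. 1)" by (simp add: t_def)
    also have "\<dots> = (\<Sum>v\<in>V. \<Sum>x | x \<in> T \<and> x a = v. 1)"
      unfolding V_def by (rule sum.image_gen[OF finT])
    finally show ?thesis by (simp add: cardS)
  qed
  have proj_a: "card (S v) \<le> card ((\<lambda>x. restrict x (insert a D - {a})) ` T)" for v
    using finT insert.hyps(2) by (intro card_mono) (auto simp: S_def insert_Diff_if)
  \<comment> \<open>Coordinate \<open>a\<close> survives the projection along \<open>i\<close>, so
    the projections of distinct slices stay disjoint and their sizes add up.\<close>
  have proj_i: "(\<Sum>v\<in>V. card ((\<lambda>x. restrict x (D - {i})) ` S v)) \<le> card ((\<lambda>x. restrict x (insert a D - {i})) ` T)"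
    if i: "i \<in> D" for i
  proof -
    let ?P = "(\<lambda>x. restrict x (insert a D - {i})) ` T"
    have ai: "a \<noteq> i" using i insert.hyps(2) by blast
    have "card ((\<lambda>x. restrict x (D - {i})) ` S v) \<le> card {z \<in> ?P. z a = v}" for v
    proof (rule surj_card_le)
      show "finite {z \<in> ?P. z a = v}" using finT by simp
      show "(\<lambda>x. restrict x (D - {i})) ` S v \<subseteq> (\<lambda>z. restrict z (D - {i})) ` {z \<in> ?P. z a = v}"
      proof
        fix w assume "w \<in> (\<lambda>x. restrict x (D - {i})) ` S v"
        then obtain x where x: "x \<in> T" "x a = v" "w = restrict (restrict x D) (D - {i})"
          by (auto simp: S_def)
        have "w = restrict (restrict x (insert a D - {i})) (D - {i})"
          unfolding x(3) by (auto simp: restrict_def fun_eq_iff)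
        moreover have "restrict x (insert a D - {i}) \<in> {z \<in> ?P. z a = v}"
          using x ai by simp
        ultimately show "w \<in> (\<lambda>z. restrict z (D - {i})) ` {z \<in> ?P. z a = v}"
          by (rule image_eqI)
      qed
    qed
    then have "(\<Sum>v\<in>V. card ((\<lambda>x. restrict x (D - {i})) ` S v)) \<le> (\<Sum>v\<in>V. card {z \<in> ?P. z a = v})"
      by (intro sum_mono)
    also have "\<dots> = (\<Sum>v\<in>(\<lambda>z. z a) ` ?P. \<Sum>z | z \<in> ?P \<and> z a = v. 1)"
      using ai by (simp add: V_def image_image)
    also have "\<dots> = (\<Sum>z\<in>?P. 1)"
      using finT by (intro sum.image_gen[symmetric]) simp
    finally show ?thesis by simp
  qed
  show ?case
  proof (cases "T = {}")
    case False
    then have Vne: "V \<noteq> {}" by (simp add: V_def)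
    define M where "M = Max ((\<lambda>v. card (S v)) ` V)"
    have leM: "card (S v) \<le> M" if "v \<in> V" for v
      unfolding M_def using finV that by (intro Max_ge) auto
    have "M \<in> (\<lambda>v. card (S v)) ` V"
      unfolding M_def using finV Vne by (intro Max_in) auto
    then obtain v0 where v0: "v0 \<in> V" "M = card (S v0)" by blast
    have M1: "M \<ge> 1"
      using v0 finS[of v0] by (auto simp: Suc_le_eq card_gt_0_iff S_def V_def)
    define \<Sigma> where "\<Sigma> = (\<Sum>v\<in>V. \<Sum>i\<in>D. real (card ((\<lambda>x. restrict x (D - {i})) ` S v)))"
    \<comment> \<open>The projection along \<open>a\<close> contains a copy of the largest slice;
      the other projections are bounded below slice by slice.\<close>
    have \<Lambda>_ge: "\<Lambda> \<ge> real M + \<Sigma>"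
    proof -
      have "\<Sigma> = (\<Sum>i\<in>D. real (\<Sum>v\<in>V. card ((\<lambda>x. restrict x (D - {i})) ` S v)))"
        unfolding \<Sigma>_def by (subst sum.swap) simp
      also have "\<dots> \<le> (\<Sum>i\<in>D. real (card ((\<lambda>x. restrict x (insert a D - {i})) ` T)))"
        by (intro sum_mono of_nat_mono proj_i)
      finally show ?thesis using proj_a[of v0] v0 insert.hyps by (simp add: \<Lambda>_def)
    qed
    have "real (Suc (card D)) * t \<le> r * \<Lambda>"
    \<comment> \<open>The root taken below needs \<open>card D > 0\<close>; for empty
      \<open>D\<close> the claim follows from \<open>t \<le> r\<close> and
      \<open>M \<ge> 1\<close>.\<close>
    proof (cases "D = {}")
      case True
      have "1 * t \<le> r * real M" using tr M1 r True mult_mono[of t r 1 "real M"] by (simp add: t_def)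
      also have "\<dots> \<le> r * \<Lambda>" using \<Lambda>_ge r True by (simp add: \<Sigma>_def)
      finally show ?thesis using True by simp
    next
      case False
      then have d: "card D > 0" using insert.hyps by (simp add: card_gt_0_iff)
      \<comment> \<open>With this parameter the induction hypothesis covers every slice, since none
        has more than \<open>M = K ^ card D\<close> points.\<close>
      define K where "K = root (card D) (real M)"
      have K: "K > 0" "K ^ card D = real M" using d M1 by (auto simp: K_def)
      have "real (card D) * t = (\<Sum>v\<in>V. real (card D) * real (card (S v)))"
        by (simp add: t_eq sum_distrib_left)
      also have "\<dots> \<le> (\<Sum>v\<in>V. K * (\<Sum>i\<in>D. real (card ((\<lambda>x. restrict x (D - {i})) ` S v))))"
        by (intro sum_mono insert.IH) (use K leM finS in \<open>auto simp: S_def\<close>)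
      also have "\<dots> = K * \<Sigma>" by (simp add: \<Sigma>_def sum_distrib_left)
      finally have 1: "real (card D) * t \<le> K * \<Sigma>" .
      have 2: "K * \<Lambda> \<ge> K ^ Suc (card D) + real (card D) * t"
        using 1 mult_left_mono[OF \<Lambda>_ge, of K] K by (simp add: distrib_left)
      \<comment> \<open>Bernoulli's inequality at \<open>x = K / r\<close> trades the parameter
        \<open>K\<close> of the slices for the given \<open>r\<close>, using
        \<open>t \<le> r ^ Suc (card D)\<close>.\<close>
      define x where "x = K / r"
      have x: "K = x * r" "x > 0" using r K by (auto simp: x_def)
      have bern: "1 + real (Suc (card D)) * (x - 1) \<le> x ^ Suc (card D)"
        using Bernoulli_inequality[of "x - 1" "Suc (card D)"] x by simp
      have t0: "t \<ge> 0" by (simp add: t_def)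
      have "real (Suc (card D)) * x * t \<le> (x ^ Suc (card D) + real (card D)) * t"
        using bern t0 by (intro mult_right_mono) (auto simp: algebra_simps)
      also have "\<dots> \<le> x ^ Suc (card D) * r ^ Suc (card D) + real (card D) * t"
        unfolding distrib_right using tr x by (intro add_right_mono mult_left_mono) auto
      also have "\<dots> = K ^ Suc (card D) + real (card D) * t"
        by (simp add: x(1) power_mult_distrib)
      also have "\<dots> \<le> x * (r * \<Lambda>)" using 2 x(1) by (simp add: mult.assoc)
      finally have "x * (real (Suc (card D)) * t) \<le> x * (r * \<Lambda>)" by (simp add: mult_ac)
      then show ?thesis using x(2) mult_le_cancel_left_pos by blast
    qed
    then show ?thesis
      unfolding \<Lambda>_def t_def card_insert_disjoint[OF insert.hyps] .
  qed simp
qed simp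

text \<open>The size limit is what permits \<open>r = card D\<close> in the projection inequality;
  the factor \<open>card D\<close> then cancels, and what remains is Hall's condition for points
  against lines.\<close>

lemma clique_guess_small_set:
  fixes S :: "('i \<Rightarrow> 'c) set"
  assumes D: "finite D" "D \<noteq> {}" and S: "finite S" "S \<subseteq> extensional D" "card S \<le> card D ^ card D"
  shows "\<exists>h. (\<forall>w\<in>D. \<forall>x x'. (\<forall>u\<in>D - {w}. x u = x' u) \<longrightarrow> h w x = h w x') \<and>
             (\<forall>x\<in>S. \<exists>w\<in>D. h w x = x w)"
proof -
  \<comment> \<open>A line through \<open>x\<close> in direction \<open>i\<close> is recorded by
    \<open>i\<close> and the remaining coordinates, which is precisely what player \<open>i\<close>
    sees.\<close>
  let ?L = "\<lambda>x. (\<lambda>i. (i, restrict x (D - {i}))) ` D"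
  have "\<exists>f. inj_on f S \<and> (\<forall>x\<in>S. f x \<in> ?L x)"
  proof (rule marriage)
    show "finite S" "\<And>x. finite (?L x)" using S D by auto
    show "card T \<le> card (\<Union>x\<in>T. ?L x)" if T: "T \<subseteq> S" for T
    proof -
      have fT: "finite T" "card T \<le> card S" using T S by (auto intro: finite_subset card_mono)
      have U: "(\<Union>x\<in>T. ?L x) = (SIGMA i:D. (\<lambda>x. restrict x (D - {i})) ` T)" by auto
      have "real (card D) * real (card T) \<le> real (card D) * (\<Sum>i\<in>D. real (card ((\<lambda>x. restrict x (D - {i})) ` T)))"
        using D T S fT by (intro card_le_sum_projections) (auto simp: card_gt_0_iff simp flip: of_nat_power)
      then show ?thesis
        using D fT unfolding U by (subst card_SigmaI) (auto simp: card_gt_0_iff simp flip: of_nat_sum)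
    qed
  qed
  then obtain f where f: "inj_on f S" "\<And>x. x \<in> S \<Longrightarrow> f x \<in> ?L x" by blast
  \<comment> \<open>Injectivity of \<open>f\<close> makes the point matched to a line unique. A line
    matched to no point yields an unspecified value, which still depends only on what
    \<open>w\<close> sees.\<close>
  define h where "h w x = (THE c. \<exists>z\<in>S. f z = (w, restrict x (D - {w})) \<and> c = z w)" for w x
  show ?thesis
  proof (intro exI conjI ballI allI impI)
    fix w and x x' :: "'i \<Rightarrow> 'c" assume "\<forall>u\<in>D - {w}. x u = x' u"
    then have "restrict x (D - {w}) = restrict x' (D - {w})" by (intro restrict_ext) blast
    then show "h w x = h w x'" by (simp add: h_def)
  next
    fix x assume x: "x \<in> S"
    then obtain w where w: "w \<in> D" "f x = (w, restrict x (D - {w}))" using f(2)[OF x] by blast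
    have "h w x = x w"
      unfolding h_def
    proof (rule the_equality)
      show "\<exists>z\<in>S. f z = (w, restrict x (D - {w})) \<and> x w = z w" using x w by blast
    next
      fix c assume "\<exists>z\<in>S. f z = (w, restrict x (D - {w})) \<and> c = z w"
      then obtain z where z: "z \<in> S" "f z = f x" "c = z w" using w by auto
      then show "c = x w" using inj_onD[OF f(1) z(2) z(1) x] by simp
    qed
    then show "\<exists>w\<in>D. h w x = x w" using w by blast
  qed
qed

section \<open>Strategies on books\<close>

text \<open>Probabilistic method in counting form: for fixed \<open>y\<close> and a fixed
  \<open>m\<close>-subset of \<open>X\<close>, a random family misses throughout with probability
  \<open>(1 - 1 / q) ^ (card P * m)\<close>. By \<open>count\<close>, the sum over the at most
  \<open>q ^ card P * card X ^ m\<close> such pairs is below 1.\<close>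

lemma exists_page_guesses:
  fixes X :: "'x set" and P :: "'p set"
  assumes fin: "finite X" "finite P" and qpos: "q > 0"
    and count: "q ^ card P * card X ^ m * (q - 1) ^ (card P * m) < q ^ (card P * m)"
  shows "\<exists>g. \<forall>y \<in> P \<rightarrow> {..<q}. card {x \<in> X. \<forall>j\<in>P. g j x \<noteq> y j} < m"
proof (rule ccontr)
  assume "\<not> ?thesis"
  then have neg: "\<exists>y \<in> P \<rightarrow> {..<q}. m \<le> card {x \<in> X. \<forall>j\<in>P. g j x \<noteq> y j}" for g
    by (auto simp: not_less)
  define F where "F = (P \<times> X) \<rightarrow>\<^sub>E {..<q}"
  define Y where "Y = P \<rightarrow>\<^sub>E {..<q}"
  define \<T> where "\<T> = {T. T \<subseteq> X \<and> card T = m}"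
  \<comment> \<open>Written as a dependent product, so that independence of the guesses becomes a
    product formula for the cardinality.\<close>
  define Bad where "Bad = (\<lambda>(y, T). PiE (P \<times> X) (\<lambda>(j, x). if x \<in> T then {..<q} - {y j} else {..<q}))"
  have finY: "finite Y" "card Y = q ^ card P" using fin by (auto simp: Y_def card_PiE finite_PiE)
  have fin\<T>: "finite \<T>" "card \<T> \<le> card X ^ m"
    using fin binomial_le_pow[of m "card X"]
    by (cases "m \<le> card X"; simp add: \<T>_def n_subsets binomial_eq_0)+
  have cardBad: "card (Bad (y, T)) = (q - 1) ^ (card P * m) * q ^ (card P * (card X - m))"
    if yT: "y \<in> Y" "T \<in> \<T>" for y T
  proof -
    have T: "T \<subseteq> X" "card T = m" "finite T" using yT fin by (auto simp: \<T>_def intro: finite_subset)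
    have "card (Bad (y, T)) = (\<Prod>(j, x)\<in>P \<times> X. if x \<in> T then q - 1 else q)"
      unfolding Bad_def prod.case using fin yT
      by (subst card_PiE) (auto intro!: prod.cong simp: Y_def PiE_iff)
    also have "\<dots> = (\<Prod>j\<in>P. \<Prod>x\<in>X. if x \<in> T then q - 1 else q)"
      by (rule prod.cartesian_product[symmetric])
    also have "(\<Prod>x\<in>X. if x \<in> T then q - 1 else q) = (q - 1) ^ m * q ^ (card X - m)"
      using fin T by (simp add: prod.If_cases Int_absorb1 Diff_eq[symmetric] card_Diff_subset)
    finally show ?thesis by (simp add: power_mult power_mult_distrib mult.commute[of "card P"])
  qed
  have finBad: "finite (Bad p)" for p
    unfolding Bad_def using fin by (auto split: prod.split intro!: finite_PiE)
  have "F \<subseteq> (\<Union>p\<in>Y \<times> \<T>. Bad p)"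
  proof
    fix f assume f: "f \<in> F"
    obtain y where y: "y \<in> P \<rightarrow> {..<q}" "m \<le> card {x \<in> X. \<forall>j\<in>P. f (j, x) \<noteq> y j}"
      using neg[of "\<lambda>j x. f (j, x)"] by blast
    obtain T where T: "T \<subseteq> {x \<in> X. \<forall>j\<in>P. f (j, x) \<noteq> y j}" "card T = m"
      using obtain_subset_with_card_n[OF y(2)] by blast
    have "restrict y P \<in> Y" "T \<in> \<T>" using y T by (auto simp: Y_def \<T>_def)
    moreover have "f \<in> Bad (restrict y P, T)"
    proof -
      have "f p \<in> (case p of (j, x) \<Rightarrow> if x \<in> T then {..<q} - {restrict y P j} else {..<q})"
        if p: "p \<in> P \<times> X" for p
      proof -
        obtain j x where jx: "p = (j, x)" "j \<in> P" "x \<in> X" using p by blast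
        have "f (j, x) < q" using f jx by (auto simp: F_def dest: PiE_mem)
        moreover have "f (j, x) \<noteq> y j" if "x \<in> T" using T(1) that jx by blast
        ultimately show ?thesis using jx by simp
      qed
      moreover have "f \<in> extensional (P \<times> X)" using f by (simp add: F_def PiE_def)
      ultimately show ?thesis by (simp add: Bad_def PiE_iff)
    qed
    ultimately show "f \<in> (\<Union>p\<in>Y \<times> \<T>. Bad p)" by blast
  qed
  then have "card F \<le> card (\<Union>p\<in>Y \<times> \<T>. Bad p)"
    using finY fin\<T> finBad by (intro card_mono) auto
  also have "\<dots> \<le> (\<Sum>p\<in>Y \<times> \<T>. card (Bad p))"
    using finY fin\<T> by (intro card_UN_le) auto
  also have "\<dots> = card Y * card \<T> * ((q - 1) ^ (card P * m) * q ^ (card P * (card X - m)))"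
  proof -
    have "(\<Sum>p\<in>Y \<times> \<T>. card (Bad p)) = (\<Sum>p\<in>Y \<times> \<T>. (q - 1) ^ (card P * m) * q ^ (card P * (card X - m)))"
      using cardBad by (intro sum.cong) auto
    then show ?thesis by (simp add: card_cartesian_product)
  qed
  also have "\<dots> \<le> q ^ card P * card X ^ m * ((q - 1) ^ (card P * m) * q ^ (card P * (card X - m)))"
    using finY fin\<T> by (intro mult_right_mono mult_mono) auto
  finally have le: "card F \<le> q ^ card P * card X ^ m * (q - 1) ^ (card P * m) * q ^ (card P * (card X - m))"
    by (simp add: mult_ac)
  have cF: "card F = q ^ (card P * card X)"
    using fin by (simp add: F_def card_PiE card_cartesian_product)
  \<comment> \<open>The truncated difference \<open>card X - m\<close> has to be genuine; the
    failure of any single family already forces \<open>m \<le> card X\<close>.\<close>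
  obtain y :: "'p \<Rightarrow> nat" where y: "m \<le> card {x \<in> X. \<forall>j\<in>P. 0 \<noteq> y j}" using neg[of "\<lambda>_ _. 0"] by blast
  have mX: "m \<le> card X" by (rule order_trans[OF y card_mono]) (use fin in auto)
  have "q ^ card P * card X ^ m * (q - 1) ^ (card P * m) * q ^ (card P * (card X - m))
        < q ^ (card P * m) * q ^ (card P * (card X - m))"
    using count qpos by simp
  also have "\<dots> = q ^ (card P * card X)"
    using mX by (simp flip: power_add distrib_left)
  finally show False using le cF by simp
qed

text \<open>This makes the \<open>GREATEST\<close> in \<open>hat_guessing_number\<close> an attained
  maximum. Without loops the other colours determine a vertex's guess, so each vertex is right on at
  most \<open>q ^ (n - 1)\<close> of the \<open>q ^ n\<close> colourings.\<close>

lemma winning_strategy_le: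
  assumes E: "E \<in> graphs n" and win: "winning_strategy n E q f"
  shows "q \<le> n"
proof (cases "q = 0")
  case False
  define H where "H w = {c \<in> colourings n q. f w c = c w}" for w
  have finC: "finite (colourings n q)" "card (colourings n q) = q ^ n"
    by (auto simp: colourings_def card_PiE intro!: finite_PiE)
  have cardH: "card (H w) \<le> q ^ (n - 1)" if w: "w < n" for w
  proof -
    have inj: "inj_on (\<lambda>c. restrict c ({0..<n} - {w})) (H w)"
    proof (rule inj_onI)
      fix c c' assume c: "c \<in> H w" "c' \<in> H w" and eq: "restrict c ({0..<n} - {w}) = restrict c' ({0..<n} - {w})"
      have off: "c u = c' u" if "u \<noteq> w" for u
        using c fun_cong[OF eq, of u] that
        by (cases "u < n") (auto simp: H_def colourings_def PiE_iff extensional_def)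
      have "{w, w} \<notin> E" using E by (auto simp: graphs_def all_edges_def)
      then have "f w c = f w c'"
        using win w off unfolding winning_strategy_def by metis
      then have "c w = c' w" using c by (simp add: H_def)
      then show "c = c'" using off by (metis ext)
    qed
    have "(\<lambda>c. restrict c ({0..<n} - {w})) ` H w \<subseteq> ({0..<n} - {w}) \<rightarrow>\<^sub>E {0..<q}"
    proof (intro image_subsetI)
      fix c assume "c \<in> H w"
      then have "c u < q" if "u < n" for u
        using that PiE_mem[of c "{0..<n}" "\<lambda>_. {0..<q}" u] by (simp add: H_def colourings_def)
      then show "restrict c ({0..<n} - {w}) \<in> ({0..<n} - {w}) \<rightarrow>\<^sub>E {0..<q}" by simp
    qed
    then have "card (H w) \<le> card (({0..<n} - {w}) \<rightarrow>\<^sub>E {0..<q})"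
      using inj by (intro card_inj_on_le) (auto intro!: finite_PiE)
    also have "\<dots> = q ^ (n - 1)" using w by (simp add: card_PiE)
    finally show ?thesis .
  qed
  have "colourings n q \<subseteq> (\<Union>w<n. H w)"
    using win by (auto simp: winning_strategy_def H_def)
  then have "q ^ n \<le> card (\<Union>w<n. H w)"
    unfolding finC(2)[symmetric] by (intro card_mono) (use finC in \<open>auto simp: H_def\<close>)
  also have "\<dots> \<le> (\<Sum>w<n. card (H w))" by (rule card_UN_le) simp
  also have "\<dots> \<le> (\<Sum>w<n. q ^ (n - 1))" by (intro sum_mono cardH) simp
  finally have le: "q ^ n \<le> n * q ^ (n - 1)" by simp
  then have "n > 0" using False by (cases n) auto
  then have "q ^ n = q * q ^ (n - 1)" by (cases n) auto
  then show ?thesis using le False by simp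
qed simp

lemma winning_strategy_imp_le_hat_guessing_number:
  assumes "E \<in> graphs n" "winning_strategy n E q f"
  shows "q \<le> hat_guessing_number n E"
  unfolding hat_guessing_number_def
  by (rule Greatest_le_nat[where b = n]) (use assms winning_strategy_le in blast)+

text \<open>By \<open>1 - 1 / q \<le> exp (- 1 / q)\<close> it suffices that
  \<open>(N + d * m) * ln q < N * m / q\<close>. The bound on \<open>m\<close> covers the term with
  \<open>N\<close> by half of the right side, the bound on \<open>N\<close> covers the other term by
  the other half.\<close>

lemma union_bound_condition:
  fixes q d m N :: nat
  assumes "q \<ge> 1" "m > 0" "2 * real q * ln (real q) \<le> real m" "2 * real q * real d * ln (real q) < real N"
  shows "q ^ N * (q ^ d) ^ m * (q - 1) ^ (N * m) < q ^ (N * m)"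
proof -
  define r where "r = real q"
  have r: "r \<ge> 1" using assms by (simp add: r_def)
  have "ln r * real N \<le> real m / (2 * r) * real N"
    using assms r by (intro mult_right_mono) (auto simp: r_def field_simps)
  moreover have "real d * ln r * real m < real N / (2 * r) * real m"
    using assms r by (intro mult_strict_right_mono) (auto simp: r_def field_simps)
  ultimately have "real (N + d * m) * ln r < real (N * m) / r"
    using r by (simp add: field_simps)
  then have "exp (real (N + d * m) * ln r) < exp (real (N * m) / r)" by simp
  moreover have "exp (real (N + d * m) * ln r) = r ^ (N + d * m)"
    using r by (subst exp_of_nat_mult) simp
  ultimately have A: "r ^ (N + d * m) < exp (real (N * m) / r)" by (simp only:)
  have "(1 - 1 / r) ^ (N * m) \<le> exp (- (1 / r)) ^ (N * m)"
    using r exp_ge_add_one_self[of "- (1 / r)"] by (intro power_mono) auto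
  also have "\<dots> = exp (- (real (N * m) / r))"
    by (subst exp_of_nat_mult[symmetric]) simp
  finally have B: "(1 - 1 / r) ^ (N * m) \<le> exp (- (real (N * m) / r))" .
  have "r ^ (N + d * m) * (1 - 1 / r) ^ (N * m) \<le> r ^ (N + d * m) * exp (- (real (N * m) / r))"
    using r by (intro mult_left_mono B) auto
  also have "\<dots> < exp (real (N * m) / r) * exp (- (real (N * m) / r))"
    by (intro mult_strict_right_mono A) simp
  also have "\<dots> = 1" by (simp flip: exp_add)
  finally have "r ^ (N + d * m) * (1 - 1 / r) ^ (N * m) * r ^ (N * m) < 1 * r ^ (N * m)"
    using r by (intro mult_strict_right_mono) auto
  moreover have "(1 - 1 / r) ^ (N * m) * r ^ (N * m) = (r - 1) ^ (N * m)"
    using r by (simp add: power_mult_distrib[symmetric] field_simps)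
  ultimately have "r ^ (N + d * m) * (r - 1) ^ (N * m) < r ^ (N * m)"
    by (simp add: mult.assoc)
  moreover have "real (q - 1) = r - 1" using assms by (simp add: r_def of_nat_diff)
  ultimately have "real (q ^ N * (q ^ d) ^ m * (q - 1) ^ (N * m)) < real (q ^ (N * m))"
    by (simp add: r_def power_add power_mult)
  then show ?thesis by (simp only: of_nat_less_iff)
qed

text \<open>Some vertex of \<open>P\<close> guesses right unless the colouring of \<open>D\<close>
  lies in \<open>S c\<close>. This set depends on the colours of \<open>P\<close> alone, so all of
  \<open>D\<close> can agree on it; having fewer than \<open>m\<close> elements, it is small enough
  for the clique to win on it.\<close>

lemma book_graph_winning_strategy:
  assumes E: "E \<in> graphs n" and D: "D \<subseteq> {0..<n}" "D \<noteq> {}" and P: "P \<subseteq> {0..<n}"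
    and clique: "\<And>u v. u \<in> D \<Longrightarrow> v \<in> D \<Longrightarrow> u \<noteq> v \<Longrightarrow> {u, v} \<in> E"
    and join: "\<And>u v. u \<in> D \<Longrightarrow> v \<in> P \<Longrightarrow> {u, v} \<in> E"
    and q: "q > 0" and m: "m \<le> Suc (card D ^ card D)"
    and count: "q ^ card P * (q ^ card D) ^ m * (q - 1) ^ (card P * m) < q ^ (card P * m)"
  shows "\<exists>f. winning_strategy n E q f"
proof -
  have fin: "finite D" "finite P" using D P by (auto intro: finite_subset)
  have noloop: "{u, u} \<notin> E" for u using E by (auto simp: graphs_def all_edges_def)
  then have disj: "D \<inter> P = {}" using join by blast
  define X where "X = D \<rightarrow>\<^sub>E {..<q}"
  have X: "finite X" "card X = q ^ card D" using fin by (auto simp: X_def card_PiE intro!: finite_PiE)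
  obtain g where g: "card {x \<in> X. \<forall>j\<in>P. g j x \<noteq> y j} < m" if "y \<in> P \<rightarrow> {..<q}" for y
    using exists_page_guesses[OF X(1) fin(2) q, of m] count X by auto
  define S where "S c = {x \<in> X. \<forall>j\<in>P. g j x \<noteq> c j}" for c :: "nat \<Rightarrow> nat"
  have SX: "S c \<subseteq> X" for c by (auto simp: S_def)
  have S_cong: "S c = S c'" if "\<And>j. j \<in> P \<Longrightarrow> c j = c' j" for c c' using that by (auto simp: S_def)
  \<comment> \<open>Here \<open>c\<close> is an arbitrary function, possibly with values outside
    \<open>{..<q}\<close>, and then \<open>S c\<close> may be too large; hence the size condition
    sits inside the conclusion.\<close>
  have "\<exists>h. (\<forall>w\<in>D. \<forall>x x'. (\<forall>u\<in>D - {w}. x u = x' u) \<longrightarrow> h w x = h w x') \<and>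
            (card (S c) \<le> card D ^ card D \<longrightarrow> (\<forall>x\<in>S c. \<exists>w\<in>D. h w x = x w))" for c
  proof (cases "card (S c) \<le> card D ^ card D")
    case True
    have "finite (S c)" "S c \<subseteq> extensional D"
      using finite_subset[OF SX X(1)] SX[of c] by (auto simp: X_def PiE_def)
    then show ?thesis using clique_guess_small_set[OF fin(1) D(2) _ _ True] by blast
  qed (auto intro: exI[of _ "\<lambda>_ _. 0"])
  \<comment> \<open>The clique strategy is chosen per set \<open>S c\<close> and not per
    \<open>c\<close>: a vertex of \<open>D\<close> does not know its own colour, but it sees enough
    to know this set.\<close>
  then have "\<forall>T\<in>range S. \<exists>h. (\<forall>w\<in>D. \<forall>x x'. (\<forall>u\<in>D - {w}. x u = x' u) \<longrightarrow> h w x = h w x') \<and>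
            (card T \<le> card D ^ card D \<longrightarrow> (\<forall>x\<in>T. \<exists>w\<in>D. h w x = x w))"
    by (simp only: ball_simps) blast
  from bchoice[OF this] obtain h where
    h: "\<forall>T\<in>range S. (\<forall>w\<in>D. \<forall>x x'. (\<forall>u\<in>D - {w}. x u = x' u) \<longrightarrow> h T w x = h T w x') \<and>
            (card T \<le> card D ^ card D \<longrightarrow> (\<forall>x\<in>T. \<exists>w\<in>D. h T w x = x w))" ..
  have h_local: "h (S c) w x = h (S c) w x'" if "w \<in> D" "\<forall>u\<in>D - {w}. x u = x' u" for c w x x'
    using h that by blast
  have h_win: "\<exists>w\<in>D. h (S c) w x = x w" if "card (S c) \<le> card D ^ card D" "x \<in> S c" for c x
    using h that by blast
  \<comment> \<open>Reduction modulo \<open>q\<close> keeps the guess below \<open>q\<close> for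
    every \<open>c\<close>; a correct guess in a colouring is already below \<open>q\<close> and
    stays unchanged.\<close>
  define f where "f w c = (if w \<in> P then g w (restrict c D) else if w \<in> D then h (S c) w c else 0) mod q" for w c
  have "winning_strategy n E q f"
    unfolding winning_strategy_def
  proof (intro conjI allI impI ballI)
    fix w and c c' :: "nat \<Rightarrow> nat" assume agree: "\<forall>u. {w, u} \<in> E \<longrightarrow> c u = c' u"
    consider "w \<in> P" | "w \<in> D" "w \<notin> P" | "w \<notin> D" "w \<notin> P" by blast
    then show "f w c = f w c'"
    proof cases
      case 1
      have "c u = c' u" if "u \<in> D" for u
        using agree join[OF that 1] by (simp add: insert_commute)
      then have "restrict c D = restrict c' D" by (rule restrict_ext)
      then show ?thesis using 1 by (simp add: f_def)
    next
      case 2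
      have "S c = S c'" using agree join[OF 2(1)] by (intro S_cong) blast
      moreover have "h (S c) w c = h (S c) w c'"
        using agree clique[OF 2(1)] 2 by (intro h_local) auto
      ultimately show ?thesis using 2 by (simp add: f_def)
    qed (simp add: f_def)
  next
    fix w c show "f w c < q" using q by (simp add: f_def)
  next
    fix c assume "c \<in> colourings n q"
    then have cq: "c u < q" if "u < n" for u
      using that PiE_mem[of c "{0..<n}" "\<lambda>_. {0..<q}" u] by (simp add: colourings_def)
    define x where "x = restrict c D"
    have xX: "x \<in> X" using cq D by (auto simp: X_def x_def)
    show "\<exists>w<n. f w c = c w"
    proof (cases "x \<in> S c")
      case False
      then obtain j where j: "j \<in> P" "g j x = c j" using xX by (auto simp: S_def)
      then have "j < n" using P by auto
      then show ?thesis using j cq by (intro exI[of _ j]) (simp add: f_def x_def)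
    next
      case True
      have "card (S c) < m" unfolding S_def using cq P by (intro g) auto
      then obtain w where w: "w \<in> D" "h (S c) w x = x w"
        using h_win[OF _ True] m by auto
      then have "h (S c) w c = x w"
        using h_local[OF w(1), of c x c] by (auto simp: x_def)
      moreover have "w < n" "w \<notin> P" using w D disj by auto
      ultimately show ?thesis using w cq by (intro exI[of _ w]) (simp add: f_def x_def)
    qed
  qed
  then show ?thesis by blast
qed

section \<open>Books in random graphs\<close>

text \<open>Independence of disjoint sets as a count: \<open>E\<close> splits into its part inside
  \<open>S j\<close>, where only the full set is excluded, and its part outside. Each index thus
  contributes \<open>2 ^ d - 1\<close> choices out of \<open>2 ^ d\<close>.\<close>

lemma card_containing_none_le:
  fixes S :: "'j \<Rightarrow> 'a set"
  assumes "finite J" "finite U" "disjoint_family_on S J"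
    and "\<And>j. j \<in> J \<Longrightarrow> S j \<subseteq> U" "\<And>j. j \<in> J \<Longrightarrow> card (S j) = d"
  shows "real (card {E. E \<subseteq> U \<and> (\<forall>j\<in>J. \<not> S j \<subseteq> E)}) \<le> 2 ^ card U * (1 - 1 / 2 ^ d) ^ card J"
  using assms
proof (induction J arbitrary: U rule: finite_induct)
  case empty
  then show ?case by (simp add: Pow_def[symmetric] card_Pow)
next
  case (insert j J)
  have Sj: "S j \<subseteq> U" "card (S j) = d" "finite (S j)"
    using insert.prems by (auto intro: finite_subset)
  have disj: "S i \<inter> S j = {}" if "i \<in> J" for i
    using insert.prems(2) insert.hyps(2) that by (auto simp: disjoint_family_on_def)
  let ?R = "{E. E \<subseteq> U - S j \<and> (\<forall>i\<in>J. \<not> S i \<subseteq> E)}"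
  let ?T = "{E. E \<subseteq> U \<and> (\<forall>i\<in>insert j J. \<not> S i \<subseteq> E)}"
  have "card ?T \<le> card ((Pow (S j) - {S j}) \<times> ?R)"
  proof (rule card_inj_on_le[where f = "\<lambda>E. (E \<inter> S j, E - S j)"])
    show "inj_on (\<lambda>E. (E \<inter> S j, E - S j)) ?T" by (auto simp: inj_on_def)
    show "(\<lambda>E. (E \<inter> S j, E - S j)) ` ?T \<subseteq> (Pow (S j) - {S j}) \<times> ?R" by auto
    show "finite ((Pow (S j) - {S j}) \<times> ?R)" using Sj insert.prems(1) by auto
  qed
  also have "\<dots> = (2 ^ d - 1) * card ?R"
    using Sj by (simp add: card_cartesian_product card_Diff_singleton card_Pow)
  finally have "real (card ?T) \<le> (2 ^ d - 1) * real (card ?R)"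
    using of_nat_mono[of "card ?T" "(2 ^ d - 1) * card ?R", where 'a = real] by (simp add: of_nat_diff)
  moreover have "real (card ?R) \<le> 2 ^ card (U - S j) * (1 - 1 / 2 ^ d) ^ card J"
  proof (rule insert.IH)
    show "disjoint_family_on S J" using insert.prems(2) by (auto simp: disjoint_family_on_def)
    show "S i \<subseteq> U - S j" if "i \<in> J" for i using that disj[OF that] insert.prems(3) by blast
  qed (use insert.prems in auto)
  ultimately have "real (card ?T) \<le> (2 ^ d - 1) * (2 ^ card (U - S j) * (1 - 1 / 2 ^ d) ^ card J)"
    by (meson mult_left_mono order_trans diff_ge_0_iff_ge two_realpow_ge_one)
  also have "(2::real) ^ card (U - S j) = 2 ^ card U / 2 ^ d"
    using Sj insert.prems(1) card_mono[OF insert.prems(1) Sj(1)]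
    by (simp add: card_Diff_subset power_diff)
  also have "(2 ^ d - 1) * (2 ^ card U / 2 ^ d * (1 - 1 / 2 ^ d) ^ card J)
      = 2 ^ card U * (1 - 1 / 2 ^ d :: real) ^ card (insert j J)"
    using insert.hyps by (simp add: field_simps)
  finally show ?case .
qed

lemma finite_all_edges: "finite (all_edges n)"
  by (rule finite_subset[of _ "Pow {0..<n}"]) (auto simp: all_edges_def)

lemma finite_graphs: "finite (graphs n)" and card_graphs: "card (graphs n) = 2 ^ card (all_edges n)"
  by (auto simp: graphs_def finite_all_edges card_Pow)

text \<open>For distinct \<open>j\<close> outside \<open>D\<close> the edge sets from
  \<open>j\<close> to \<open>D\<close> are disjoint, so the events are independent. Vertices of
  \<open>B\<close> inside \<open>D\<close> are discarded, whence the exponent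
  \<open>card B - card D\<close>.\<close>

lemma card_no_common_neighbour_le:
  assumes D: "D \<subseteq> {0..<n}" and B: "B \<subseteq> {0..<n}"
  shows "real (card {E \<in> graphs n. \<forall>j\<in>B. \<exists>u\<in>D. {u, j} \<notin> E})
    \<le> real (card (graphs n)) * (1 - 1 / 2 ^ card D) ^ (card B - card D)"
proof -
  have fin: "finite D" "finite B" using D B by (auto intro: finite_subset)
  define S where "S j = (\<lambda>u. {u, j}) ` D" for j
  have "card {E \<in> graphs n. \<forall>j\<in>B. \<exists>u\<in>D. {u, j} \<notin> E}
      \<le> card {E. E \<subseteq> all_edges n \<and> (\<forall>j\<in>B - D. \<not> S j \<subseteq> E)}"
    by (intro card_mono) (auto simp: graphs_def S_def finite_all_edges)
  also have "real \<dots> \<le> 2 ^ card (all_edges n) * (1 - 1 / 2 ^ card D) ^ card (B - D)"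
  proof (rule card_containing_none_le)
    show "disjoint_family_on S (B - D)"
      by (auto simp: disjoint_family_on_def S_def doubleton_eq_iff)
    show "S j \<subseteq> all_edges n" if "j \<in> B - D" for j
      using that D B by (auto simp: S_def all_edges_def card_2_iff)
    show "card (S j) = card D" for j
      unfolding S_def by (intro card_image) (auto simp: inj_on_def doubleton_eq_iff)
  qed (use fin finite_all_edges in auto)
  also have "\<dots> \<le> 2 ^ card (all_edges n) * (1 - 1 / 2 ^ card D) ^ (card B - card D)"
    using fin by (intro mult_left_mono power_decreasing diff_card_le_card_Diff) auto
  finally show ?thesis by (simp add: card_graphs)
qed

definition block :: "nat \<Rightarrow> nat \<Rightarrow> nat set" where
  "block b i = {i * b..<i * b + b}"

text \<open>
  Asking for a common neighbour in each of \<open>N\<close> disjoint blocks, rather than for \<open>N\<close> common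
  neighbours, turns the probability bound into a union bound without tail estimates.
\<close>

definition rich :: "nat \<Rightarrow> nat \<Rightarrow> nat \<Rightarrow> nat \<Rightarrow> nat set set \<Rightarrow> bool" where
  "rich n d N b E \<longleftrightarrow>
     (\<forall>D. D \<subseteq> {0..<n} \<longrightarrow> card D = d \<longrightarrow> (\<forall>i<N. \<exists>j\<in>block b i. \<forall>u\<in>D. {u, j} \<in> E))"

lemma block_subset:
  assumes "N * b \<le> n" "i < N"
  shows "block b i \<subseteq> {0..<n}"
proof -
  have "Suc i * b \<le> N * b" using assms(2) by (intro mult_right_mono) auto
  then show ?thesis using assms(1) by (auto simp: block_def)
qed

lemma disjoint_family_block: "disjoint_family (block b)"
proof -
  have "i = k" if "x \<in> block b i" "x \<in> block b k" for x i k
  proof -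
    have "x div b = i" if "x \<in> block b i" for i
      using that by (intro div_nat_eqI) (auto simp: block_def mult.commute)
    then show ?thesis using that by blast
  qed
  then show ?thesis by (auto simp: disjoint_family_on_def)
qed

text \<open>Union bound over at most \<open>n ^ d\<close> sets \<open>D\<close> and \<open>N\<close>
  blocks, each block failing to contain a common neighbour of \<open>D\<close>.\<close>

lemma card_not_rich_le:
  assumes "N * b \<le> n"
  shows "real (card {E \<in> graphs n. \<not> rich n d N b E})
    \<le> real (card (graphs n)) * (real n ^ d * real N * (1 - 1 / 2 ^ d) ^ (b - d))"
proof -
  define \<D> where "\<D> = {D. D \<subseteq> {0..<n} \<and> card D = d}"
  have fin\<D>: "finite \<D>" and card\<D>: "card \<D> \<le> n ^ d"
    using binomial_le_pow[of d n] by (cases "d \<le> n"; simp add: \<D>_def n_subsets binomial_eq_0)+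
  define Bad where "Bad p = {E \<in> graphs n. \<forall>j\<in>block b (snd p). \<exists>u\<in>fst p. {u, j} \<notin> E}" for p
  have "card {E \<in> graphs n. \<not> rich n d N b E} \<le> card (\<Union>p\<in>\<D> \<times> {..<N}. Bad p)"
  proof (rule card_mono)
    show "finite (\<Union>p\<in>\<D> \<times> {..<N}. Bad p)"
      using fin\<D> finite_graphs by (auto simp: Bad_def)
    show "{E \<in> graphs n. \<not> rich n d N b E} \<subseteq> (\<Union>p\<in>\<D> \<times> {..<N}. Bad p)"
    proof
      fix E assume "E \<in> {E \<in> graphs n. \<not> rich n d N b E}"
      then obtain D i where "D \<in> \<D>" "i < N" "E \<in> Bad (D, i)"
        by (auto simp: rich_def \<D>_def Bad_def)
      then show "E \<in> (\<Union>p\<in>\<D> \<times> {..<N}. Bad p)" by blast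
    qed
  qed
  also have "\<dots> \<le> (\<Sum>p\<in>\<D> \<times> {..<N}. card (Bad p))"
    using fin\<D> by (intro card_UN_le) auto
  also have "real \<dots> \<le> (\<Sum>p\<in>\<D> \<times> {..<N}. real (card (graphs n)) * (1 - 1 / 2 ^ d) ^ (b - d))"
    unfolding of_nat_sum
  proof (rule sum_mono)
    fix p assume "p \<in> \<D> \<times> {..<N}"
    then have p: "fst p \<subseteq> {0..<n}" "card (fst p) = d" "snd p < N"
      by (auto simp: \<D>_def)
    show "real (card (Bad p)) \<le> real (card (graphs n)) * (1 - 1 / 2 ^ d) ^ (b - d)"
      using card_no_common_neighbour_le[OF p(1) block_subset[OF assms p(3)]] p(2) by (simp add: Bad_def block_def)
  qed
  also have "\<dots> = real (card \<D>) * (real (card (graphs n)) * real N * (1 - 1 / 2 ^ d) ^ (b - d))"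
    by (simp add: card_cartesian_product)
  also have "\<dots> \<le> real n ^ d * (real (card (graphs n)) * real N * (1 - 1 / 2 ^ d) ^ (b - d))"
    using card\<D> by (intro mult_right_mono) (auto simp flip: of_nat_power)
  finally show ?thesis by (simp add: mult_ac)
qed

text \<open>Richness concerns every \<open>d\<close>-set, not only cliques, so a clique can be grown
  greedily by adding common neighbours.\<close>

lemma rich_imp_clique:
  assumes E: "E \<in> graphs n" and rich: "rich n d N b E" and "N > 0" "N * b \<le> n" "d \<le> n" "k \<le> d"
  shows "\<exists>C \<subseteq> {0..<n}. card C = k \<and> (\<forall>u\<in>C. \<forall>v\<in>C. u \<noteq> v \<longrightarrow> {u, v} \<in> E)"
  using assms(6)
proof (induction k)
  case (Suc k)
  then obtain C where C: "C \<subseteq> {0..<n}" "card C = k" "\<forall>u\<in>C. \<forall>v\<in>C. u \<noteq> v \<longrightarrow> {u, v} \<in> E"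
    by auto
  \<comment> \<open>Richness speaks only of sets with exactly \<open>d\<close> elements, so the
    smaller clique is padded first.\<close>
  obtain D where D: "C \<subseteq> D" "D \<subseteq> {0..<n}" "card D = d"
    using exists_subset_between[of C d "{0..<n}"] C Suc.prems assms(5) by auto
  obtain j where j: "j \<in> block b 0" "\<forall>u\<in>D. {u, j} \<in> E"
    using rich D assms(3) unfolding rich_def by blast
  have "{j, j} \<notin> E" using E by (auto simp: graphs_def all_edges_def)
  then have "j \<notin> C" using j D by blast
  moreover have "finite C" using C by (auto intro: finite_subset)
  moreover have "j < n" using block_subset[OF assms(4,3)] j by auto
  ultimately show ?case
    using C j D by (intro exI[of _ "insert j C"]) (auto simp: insert_commute)
qed (auto intro: exI[of _ "{}"])

text \<open>One common neighbour of the clique is taken from each block; disjointness of the blocks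
  makes these \<open>N\<close> vertices distinct.\<close>

lemma rich_imp_book:
  assumes E: "E \<in> graphs n" and rich: "rich n d N b E" and "N > 0" "N * b \<le> n" "d \<le> n"
  shows "\<exists>D P. D \<subseteq> {0..<n} \<and> P \<subseteq> {0..<n} \<and> card D = d \<and> card P = N \<and>
    (\<forall>u\<in>D. \<forall>v\<in>D. u \<noteq> v \<longrightarrow> {u, v} \<in> E) \<and> (\<forall>u\<in>D. \<forall>v\<in>P. {u, v} \<in> E)"
proof -
  obtain D where D: "D \<subseteq> {0..<n}" "card D = d" "\<forall>u\<in>D. \<forall>v\<in>D. u \<noteq> v \<longrightarrow> {u, v} \<in> E"
    using rich_imp_clique[OF assms order_refl] by blast
  have "\<forall>i. \<exists>j. i < N \<longrightarrow> j \<in> block b i \<and> (\<forall>u\<in>D. {u, j} \<in> E)"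
    using rich D(1,2) unfolding rich_def by blast
  then obtain p where p: "\<And>i. i < N \<Longrightarrow> p i \<in> block b i \<and> (\<forall>u\<in>D. {u, p i} \<in> E)"
    by metis
  have "inj_on p {..<N}"
  proof (rule inj_onI, rule ccontr)
    fix i k assume ik: "i \<in> {..<N}" "k \<in> {..<N}" "p i = p k" "i \<noteq> k"
    have "block b i \<inter> block b k = {}"
      using disjoint_family_onD[OF disjoint_family_block _ _ ik(4)] by blast
    then show False using p[of i] p[of k] ik by auto
  qed
  then have "card (p ` {..<N}) = N" by (simp add: card_image)
  moreover have "p ` {..<N} \<subseteq> {0..<n}" using p block_subset[OF assms(4)] by blast
  ultimately show ?thesis using D p by (intro exI[of _ D] exI[of _ "p ` {..<N}"]) auto
qed

section \<open>Choice of parameters\<close>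

text \<open>\<open>d\<close> is the clique size, \<open>q\<close> the number of colours,
  \<open>N\<close> the number of pages and \<open>b\<close> the block length. The logarithmic
  inequalities feed the union bound for the page guesses; the last inequality bounds the probability
  of not being rich.\<close>

lemma eventually_parameters:
  fixes \<epsilon> :: real
  assumes \<epsilon>: "0 < \<epsilon>" "\<epsilon> < 1"
  shows "\<forall>\<^sub>F n in sequentially. \<exists>d q N b :: nat.
    0 < d \<and> d \<le> n \<and> 0 < N \<and> N * b \<le> n \<and> 0 < q \<and> real n powr (1 - \<epsilon>) \<le> real q \<and>
    2 * real q * ln (real q) \<le> real (d ^ d) \<and> 2 * real q * real d * ln (real q) < real N \<and>
    real n ^ d * real N * (1 - 1 / 2 ^ d) ^ (b - d) \<le> 1 / real n"
proof -
  have ceil: "z \<le> real (nat \<lceil>z\<rceil>)" "real (nat \<lceil>z\<rceil>) \<le> z + 1" if "z \<ge> 0" for z :: real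
    using that by linarith+
  define L where "L = (\<lambda>x::real. ln x)"
  \<comment> \<open>\<open>\<delta>\<close> solves \<open>\<delta>\<^bsup>\<delta>\<^esup> \<ge> n\<close> while \<open>2\<^bsup>\<delta>\<^esup> = n\<^bsup>o(1)\<^esup>\<close>.\<close>
  define \<delta> where "\<delta> = (\<lambda>x::real. 2 * ln x / ln (ln x))"
  \<comment> \<open>The last conjunct yields \<open>N * b \<le> n\<close>: its left side is
    \<open>x powr (1 - \<epsilon>)\<close> up to a factor \<open>x powr o(1)\<close>. The factor 2
    in \<open>\<delta>\<close> leaves room for lower-order terms, since
    \<open>\<delta> x * ln (\<delta> x)\<close> grows like \<open>2 * ln x\<close>.\<close>
  define large where "large = (\<lambda>x. x \<ge> 1 \<and> L x \<ge> 1 \<and> L x \<le> x \<and> \<delta> x \<ge> 1 \<and> \<delta> x + 1 \<le> L x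
      \<and> L x \<le> \<delta> x * ln (\<delta> x) \<and> 2 * (2 * x powr (1 - \<epsilon>)) * L x \<le> x
      \<and> (2 * (2 * x powr (1 - \<epsilon>)) * L x * L x + 2) * (2 powr (\<delta> x + 1) * (L x + 2) * L x + 1 + L x) \<le> x)"
  have "\<forall>\<^sub>F x in at_top. large x"
    unfolding large_def L_def \<delta>_def using \<epsilon> by (intro eventually_conj; real_asymp)
  from eventually_compose_filterlim[OF this filterlim_real_sequentially] show ?thesis
  proof (rule eventually_mono)
    fix n :: nat
    define x where "x = real n"
    define l where "l = L x"
    define y where "y = x powr (1 - \<epsilon>)"
    assume "large (real n)"
    then have x1: "x \<ge> 1" and l1: "l \<ge> 1" and lx: "l \<le> x" and \<delta>1: "\<delta> x \<ge> 1" and \<delta>l: "\<delta> x + 1 \<le> l"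
      and l\<delta>: "l \<le> \<delta> x * ln (\<delta> x)" and yx: "2 * (2 * y) * l \<le> x"
      and big: "(2 * (2 * y) * l * l + 2) * (2 powr (\<delta> x + 1) * (l + 2) * l + 1 + l) \<le> x"
      by (simp_all add: large_def x_def l_def y_def)
    define d where "d = nat \<lceil>\<delta> x\<rceil>"
    have d: "\<delta> x \<le> real d" "real d \<le> \<delta> x + 1" using ceil[of "\<delta> x"] \<delta>1 unfolding d_def by linarith+
    then have dl: "real d \<le> l" "real d \<ge> 1" using \<delta>l \<delta>1 by linarith+
    define q where "q = nat \<lceil>y\<rceil>"
    have y1: "y \<ge> 1" using x1 \<epsilon> by (simp add: y_def ge_one_powr_ge_zero)
    have q: "y \<le> real q" "real q \<le> 2 * y" using ceil[of y] y1 unfolding q_def by linarith+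
    have q1: "real q \<ge> 1" using q y1 by linarith
    have "2 * (2 * y) * 1 \<le> 2 * (2 * y) * l" using l1 y1 by (intro mult_left_mono) auto
    then have "real q \<le> x" using q yx y1 by linarith
    then have lnq: "ln (real q) \<le> l" "0 \<le> ln (real q)" using q1 by (auto simp: l_def L_def)
    define s where "s = 2 * real q * real d * ln (real q)"
    have s: "s \<le> 2 * (2 * y) * l * l"
      unfolding s_def using q dl lnq l1 y1 by (intro mult_mono) auto
    have s0: "s \<ge> 0" unfolding s_def using lnq by simp
    \<comment> \<open>The added 1 makes \<open>s < N\<close> strict even when \<open>s\<close> is an
      integer, and keeps \<open>N\<close> positive.\<close>
    define N where "N = nat \<lceil>s\<rceil> + 1"
    have N: "s < real N" "real N \<le> 2 * (2 * y) * l * l + 2" using ceil[of s] s s0 unfolding N_def of_nat_add of_nat_1 by linarith+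
    \<comment> \<open>With \<open>t\<close> candidates, a block fails with probability at most
      \<open>exp (- t / 2 ^ d) = 1 / x ^ (d + 2)\<close>. Of these powers, \<open>d\<close> pay for
      the choice of \<open>D\<close>, one for the \<open>N \<le> x\<close> blocks, and one remains
      as the error.\<close>
    define t where "t = 2 ^ d * (real d + 2) * l"
    have "(2::real) ^ d = 2 powr real d" by (simp add: powr_realpow)
    also have "\<dots> \<le> 2 powr (\<delta> x + 1)" using d by simp
    finally have t: "t \<le> 2 powr (\<delta> x + 1) * (l + 2) * l"
      unfolding t_def using dl l1 by (intro mult_mono) auto
    have t0: "t \<ge> 0" unfolding t_def using l1 by simp
    \<comment> \<open>Adding \<open>d\<close> makes up for the vertices of a block that may lie in
      \<open>D\<close>.\<close>
    define b where "b = nat \<lceil>t\<rceil> + d"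
    have b: "t \<le> real (b - d)" "real b \<le> 2 powr (\<delta> x + 1) * (l + 2) * l + 1 + l" "real b \<ge> 1"
      using ceil[OF t0] t dl unfolding b_def of_nat_add add_diff_cancel_right' by linarith+
    have "real N * real b \<le> (2 * (2 * y) * l * l + 2) * (2 powr (\<delta> x + 1) * (l + 2) * l + 1 + l)"
      using N b y1 l1 by (intro mult_mono) auto
    then have Nb: "real N * real b \<le> x" using big by linarith
    have "real N * 1 \<le> real N * real b" using b by (intro mult_left_mono) auto
    then have Nx: "real N \<le> x" using Nb by linarith
    have xpow: "exp (real k * l) = x ^ k" for k
      using x1 by (simp add: exp_of_nat_mult l_def L_def)
    \<comment> \<open>\<open>n\<close> is at least \<open>2 * q * ln q\<close>, and
      \<open>d ^ d\<close> is at least \<open>n\<close> because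
      \<open>\<delta> x * ln (\<delta> x) \<ge> ln x\<close>.\<close>
    have qd: "2 * real q * ln (real q) \<le> real (d ^ d)"
    proof -
      have "2 * real q * ln (real q) \<le> 2 * (2 * y) * l" using q lnq y1 by (intro mult_mono) auto
      also have "\<dots> \<le> exp l" using yx x1 by (simp add: l_def L_def)
      also have "\<dots> \<le> exp (real d * ln (real d))"
      proof -
        have "\<delta> x * ln (\<delta> x) \<le> real d * ln (real d)" using d \<delta>1 by (intro mult_mono) auto
        then show ?thesis using l\<delta> by simp
      qed
      also have "\<dots> = real (d ^ d)" using dl by (simp add: exp_of_nat_mult)
      finally show ?thesis .
    qed
    have "(1 - 1 / 2 ^ d) ^ (b - d) \<le> exp (- (1 / 2 ^ d) :: real) ^ (b - d)"
      using exp_ge_add_one_self[of "- (1 / 2 ^ d)"] by (intro power_mono) auto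
    also have "\<dots> = exp (- (real (b - d) / 2 ^ d))" by (subst exp_of_nat_mult[symmetric]) simp
    also have "\<dots> \<le> exp (- ((real d + 2) * l))"
      using b(1) by (simp add: t_def field_simps)
    also have "\<dots> = 1 / x ^ (d + 2)" using xpow[of "d + 2"] by (simp add: exp_minus inverse_eq_divide add.commute)
    finally have "x ^ d * real N * (1 - 1 / 2 ^ d) ^ (b - d) \<le> x ^ d * x * (1 / x ^ (d + 2))"
      using Nx x1 by (intro mult_mono) auto
    also have "\<dots> = 1 / x" using x1 by (simp add: field_simps power2_eq_square)
    finally have err: "x ^ d * real N * (1 - 1 / 2 ^ d) ^ (b - d) \<le> 1 / x" .
    have "N * b \<le> n" using Nb by (simp add: x_def flip: of_nat_mult)
    moreover have "d \<le> n" using dl lx by (simp add: x_def)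
    moreover have "N > 0" by (simp add: N_def)
    ultimately show "\<exists>d q N b :: nat.
      0 < d \<and> d \<le> n \<and> 0 < N \<and> N * b \<le> n \<and> 0 < q \<and> real n powr (1 - \<epsilon>) \<le> real q \<and>
      2 * real q * ln (real q) \<le> real (d ^ d) \<and> 2 * real q * real d * ln (real q) < real N \<and>
      real n ^ d * real N * (1 - 1 / 2 ^ d) ^ (b - d) \<le> 1 / real n"
      using dl q1 qd N(1) err q(1)
      by (intro exI[of _ d] exI[of _ q] exI[of _ N] exI[of _ b]) (auto simp: s_def x_def y_def)
  qed
qed

section \<open>Assembly of the strategy and the limit\<close>

lemma winning_strategy_of_rich:
  assumes E: "E \<in> graphs n" "rich n d N b E"
    and pos: "0 < d" "0 < N" "0 < q" and n: "N * b \<le> n" "d \<le> n"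
    and q: "2 * real q * ln (real q) \<le> real (d ^ d)" "2 * real q * real d * ln (real q) < real N"
  shows "\<exists>f. winning_strategy n E q f"
proof -
  obtain D P where D: "D \<subseteq> {0..<n}" "card D = d" and P: "P \<subseteq> {0..<n}" "card P = N"
    and adj: "\<forall>u\<in>D. \<forall>v\<in>D. u \<noteq> v \<longrightarrow> {u, v} \<in> E" "\<forall>u\<in>D. \<forall>v\<in>P. {u, v} \<in> E"
    using rich_imp_book[OF E pos(2) n] by blast
  \<comment> \<open>With \<open>m = d ^ d\<close>, the capacity of the clique, the two bounds on
    \<open>q\<close> are exactly those required by the union bound.\<close>
  have "q ^ N * (q ^ d) ^ (d ^ d) * (q - 1) ^ (N * d ^ d) < q ^ (N * d ^ d)"
    using pos q by (intro union_bound_condition) auto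
  then show ?thesis
    using D P adj pos
    by (intro book_graph_winning_strategy[OF E(1) D(1) _ P(1), where m = "d ^ d"]) auto
qed

text \<open>Every rich graph reaches the bound, so the graphs that miss it are among the non-rich
  ones, a fraction of at most \<open>1 / n\<close>.\<close>

lemma powr_le_hat_guessing_number_fraction:
  fixes \<epsilon> :: real
  assumes "0 < \<epsilon>" "\<epsilon> < 1"
  shows "\<forall>\<^sub>F n in sequentially. 1 - 1 / real n \<le>
    real (card {E \<in> graphs n. real (hat_guessing_number n E) \<ge> real n powr (1 - \<epsilon>)}) / real (card (graphs n))"
  using eventually_parameters[OF assms]
proof (rule eventually_mono)
  fix n
  assume "\<exists>d q N b :: nat.
    0 < d \<and> d \<le> n \<and> 0 < N \<and> N * b \<le> n \<and> 0 < q \<and> real n powr (1 - \<epsilon>) \<le> real q \<and>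
    2 * real q * ln (real q) \<le> real (d ^ d) \<and> 2 * real q * real d * ln (real q) < real N \<and>
    real n ^ d * real N * (1 - 1 / 2 ^ d) ^ (b - d) \<le> 1 / real n"
  then obtain d q N b :: nat where pos: "0 < d" "0 < N" "0 < q" and n: "N * b \<le> n" "d \<le> n"
    and q: "2 * real q * ln (real q) \<le> real (d ^ d)" "2 * real q * real d * ln (real q) < real N"
    and nq: "real n powr (1 - \<epsilon>) \<le> real q"
    and err: "real n ^ d * real N * (1 - 1 / 2 ^ d) ^ (b - d) \<le> 1 / real n"
    by blast
  let ?H = "{E \<in> graphs n. real (hat_guessing_number n E) \<ge> real n powr (1 - \<epsilon>)}"
  let ?B = "{E \<in> graphs n. \<not> rich n d N b E}"
  have "graphs n \<subseteq> ?H \<union> ?B"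
  proof
    fix E assume E: "E \<in> graphs n"
    show "E \<in> ?H \<union> ?B"
    proof (cases "rich n d N b E")
      case True
      obtain f where "winning_strategy n E q f"
        using winning_strategy_of_rich[OF E True pos n q] by blast
      then have "q \<le> hat_guessing_number n E"
        by (rule winning_strategy_imp_le_hat_guessing_number[OF E])
      then have "real n powr (1 - \<epsilon>) \<le> real (hat_guessing_number n E)" using nq by linarith
      then show ?thesis using E by simp
    qed (use E in simp)
  qed
  then have "card (graphs n) \<le> card (?H \<union> ?B)"
    using finite_graphs[of n] by (intro card_mono) auto
  also have "\<dots> \<le> card ?H + card ?B" by (rule card_Un_le)
  finally have "real (card (graphs n)) \<le> real (card ?H) + real (card ?B)" by linarith
  also have "real (card ?B) \<le> real (card (graphs n)) * (real n ^ d * real N * (1 - 1 / 2 ^ d) ^ (b - d))"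
    by (rule card_not_rich_le[OF n(1)])
  also have "\<dots> \<le> real (card (graphs n)) * (1 / real n)" by (intro mult_left_mono err) simp
  finally show "1 - 1 / real n \<le> real (card ?H) / real (card (graphs n))"
    by (simp add: card_graphs field_simps)
qed

theorem theorem2:
  fixes \<epsilon> :: real
  assumes "\<epsilon> > 0"
  shows "(\<lambda>n. real (card {E \<in> graphs n. real (hat_guessing_number n E) \<ge> real n powr (1 - \<epsilon>)})
              / real (card (graphs n))) \<longlonglongrightarrow> 1"
proof (rule tendsto_sandwich)
  \<comment> \<open>The choice of parameters requires \<open>\<epsilon> < 1\<close>; since a smaller
    value only strengthens the bound, it may be capped at \<open>1 / 2\<close>.\<close>
  define \<epsilon>' where "\<epsilon>' = min \<epsilon> (1 / 2)"
  have \<epsilon>': "0 < \<epsilon>'" "\<epsilon>' < 1" "\<epsilon>' \<le> \<epsilon>" using assms by (auto simp: \<epsilon>'_def)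
  show "\<forall>\<^sub>F n in sequentially. 1 - 1 / real n \<le>
    real (card {E \<in> graphs n. real (hat_guessing_number n E) \<ge> real n powr (1 - \<epsilon>)}) / real (card (graphs n))"
    using powr_le_hat_guessing_number_fraction[OF \<epsilon>'(1,2)] eventually_ge_at_top[of 1]
  proof eventually_elim
    case (elim n)
    have "real n powr (1 - \<epsilon>) \<le> real n powr (1 - \<epsilon>')" using elim \<epsilon>' by (intro powr_mono) auto
    then have "card {E \<in> graphs n. real (hat_guessing_number n E) \<ge> real n powr (1 - \<epsilon>')}
        \<le> card {E \<in> graphs n. real (hat_guessing_number n E) \<ge> real n powr (1 - \<epsilon>)}"
      using finite_graphs by (intro card_mono) auto
    then have "real (card {E \<in> graphs n. real (hat_guessing_number n E) \<ge> real n powr (1 - \<epsilon>')}) / real (card (graphs n))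
        \<le> real (card {E \<in> graphs n. real (hat_guessing_number n E) \<ge> real n powr (1 - \<epsilon>)}) / real (card (graphs n))"
      by (intro divide_right_mono) auto
    with elim(1) show ?case by (rule order_trans)
  qed
  show "\<forall>\<^sub>F n in sequentially.
    real (card {E \<in> graphs n. real (hat_guessing_number n E) \<ge> real n powr (1 - \<epsilon>)}) / real (card (graphs n)) \<le> 1"
  proof (intro always_eventually allI)
    fix n
    have "card {E \<in> graphs n. real (hat_guessing_number n E) \<ge> real n powr (1 - \<epsilon>)} \<le> card (graphs n)"
      using finite_graphs by (intro card_mono) auto
    then show "real (card {E \<in> graphs n. real (hat_guessing_number n E) \<ge> real n powr (1 - \<epsilon>)}) / real (card (graphs n)) \<le> 1"
      by (simp add: card_graphs)
  qed
  show "(\<lambda>n. 1 - 1 / real n) \<longlonglongrightarrow> 1" by real_asymp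
qed simp

end
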